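(* Let $a,b\in S^1(0,1)\cap\mathbb{H}^2$, and put \[ u=\frac{1+ab}{a+b},\qquad t=\frac{|a-b|}{|a-\overline{b}|}=\frac{|a-b|}{|ab-1|},\qquad T=\frac{\left(1+\sqrt{1-|u|^2}\right)\,t\,\sqrt{1-t^2}}{\sqrt{1-|u|^2t^2}}. \] Then \[ \sin\left(v_{\mathbb{H}^2}(a,b)\right)=T=\frac{|a-b|}{|ab-1|}\left(\frac12|a+b|+\sqrt{\operatorname{Im}(a)\cdot\operatorname{Im}(b)}\right). \]
   Context: The plane $\mathbb{R}^2$ is identified with $\mathbb{C}$. $\mathbb{H}^2=\{z\in\mathbb{C}:\operatorname{Im}(z)>0\}$ is the upper half plane, with boundary $\partial\mathbb{H}^2=\mathbb{R}$, and $S^1(0,1)=\{z\in\mathbb{C}:|z|=1\}$ is the unit circle. The visual angle metric of $\mathbb{H}^2$ is \[ v_{\mathbb{H}^2}(a,b)=\sup\{\measuredangle(a,z,b): z\in\partial\mathbb{H}^2\}, \] where $\measuredangle(a,z,b)\in[0,\pi]$ is the Euclidean angle at the vertex $z$ between the segments $[z,a]$ and $[z,b]$. *)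

theory Defs
  imports "HOL-Analysis.Analysis"
begin

definition upper_half_plane :: "complex set" where
  "upper_half_plane = {z. Im z > 0}"

text \<open>
  The Euclidean angle in \<open>[0, \<pi>]\<close> at the vertex \<open>z\<close> between the segments
  \<open>[z, a]\<close> and \<open>[z, b]\<close>. It is meaningful only for \<open>z \<noteq> a\<close> and \<open>z \<noteq> b\<close>;
  otherwise division by zero yields \<open>arccos 0 = \<pi> / 2\<close>.
\<close>
definition euclidean_angle :: "complex \<Rightarrow> complex \<Rightarrow> complex \<Rightarrow> real" where
  "euclidean_angle a z b = arccos (((a - z) \<bullet> (b - z)) / (norm (a - z) * norm (b - z)))"

text \<open>
  The frontier is taken in \<open>\<complex>\<close> (without the point at infinity). For points \<open>a\<close>, \<open>b\<close> of an
  open set \<open>G\<close> with nonempty frontier, the set below is nonempty and contained in \<open>[0, \<pi>]\<close>,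
  so the real supremum is the usual one.
\<close>
definition visual_angle_metric :: "complex set \<Rightarrow> complex \<Rightarrow> complex \<Rightarrow> real" where
  "visual_angle_metric G a b = (SUP z \<in> frontier G. euclidean_angle a z b)"

lemma frontier_upper_half_plane: "frontier upper_half_plane = \<real>"
proof -
  have *: "upper_half_plane = {z. \<i> \<bullet> z > 0}"
    unfolding upper_half_plane_def by simp
  have "frontier upper_half_plane = {z. \<i> \<bullet> z = 0}"
    unfolding * by (rule frontier_halfspace_gt) simp
  then show ?thesis
    by (simp only: set_eq_iff mem_Collect_eq complex_is_Real_iff) simp
qed

end

theory Submission
  imports Defs
begin

text \<open>
  Write \<open>a = m n\<close> and \<open>b = m \<cdot> cnj n\<close> with \<open>m = k + \<i> l\<close>, \<open>n = c + \<i> d\<close> on the unit circle and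
  \<open>c, l > 0\<close>; then \<open>u = k / c\<close>, \<open>t = \<bar>d\<bar> / l\<close> and \<open>Im a Im b = c\<^sup>2 - k\<^sup>2 = s\<^sup>2\<close>. Seen from a real
  point \<open>x\<close>, the dot product of \<open>a - x\<close> and \<open>b - x\<close> is \<open>N = x\<^sup>2 - 1 + 2c (c - x k)\<close> and the modulus of
  their cross product is \<open>2 \<bar>d\<bar> \<bar>c - x k\<bar>\<close>. The visual angle is taken at the point where a circle
  through \<open>a\<close> and \<open>b\<close> touches the real line, namely \<open>x = k / (c + s)\<close>: up to a positive factor, the
  bound on the cotangent \<open>N / (2 \<bar>d\<bar> \<bar>c - x k\<bar>)\<close> is \<open>(x - k / (c + s))\<^sup>2 \<ge> 0\<close>. On the other side of the
  line through \<open>a\<close> and \<open>b\<close> (where \<open>x k > c\<close>) the second touching point \<open>k / (c - s)\<close> gives a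
  stronger bound.
\<close>

text \<open>\<open>m\<close> sits at half the sum of the arguments of \<open>a\<close> and
  \<open>b\<close>, \<open>n\<close> at half their difference. Both arguments lie in (0, \<pi>), so
  the half-sum has positive sine and the half-difference, of absolute value below \<pi> / 2, has
  positive cosine.\<close>

lemma unit_upper_pair_decomposition:
  fixes a b :: complex
  assumes "cmod a = 1" "Im a > 0" "cmod b = 1" "Im b > 0"
  obtains c d k l :: real where
    "c > 0" "l > 0" "c\<^sup>2 + d\<^sup>2 = 1" "k\<^sup>2 + l\<^sup>2 = 1"
    "a = Complex (k * c - l * d) (l * c + k * d)" "b = Complex (k * c + l * d) (l * c - k * d)"
proof -
  define \<alpha> \<beta> where "\<alpha> = Arg a" and "\<beta> = Arg b"
  have A: "a = cis \<alpha>" "b = cis \<beta>"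
    using assms cis_Arg[of a] cis_Arg[of b]
    by (fastforce simp: \<alpha>_def \<beta>_def sgn_div_norm)+
  have B: "0 < \<alpha>" "\<alpha> < pi" "0 < \<beta>" "\<beta> < pi"
    using assms Arg_lt_pi[of a] Arg_lt_pi[of b] by (auto simp: \<alpha>_def \<beta>_def)
  define \<sigma> \<delta> where "\<sigma> = (\<alpha> + \<beta>) / 2" and "\<delta> = (\<alpha> - \<beta>) / 2"
  have \<alpha>\<beta>: "\<alpha> = \<sigma> + \<delta>" "\<beta> = \<sigma> - \<delta>"
    by (simp_all add: \<sigma>_def \<delta>_def field_simps)
  show ?thesis
  proof (rule that[of "cos \<delta>" "sin \<sigma>" "sin \<delta>" "cos \<sigma>"])
    show "cos \<delta> > 0" using B by (intro cos_gt_zero_pi) (auto simp: \<delta>_def)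
    show "sin \<sigma> > 0" using B by (intro sin_gt_zero) (auto simp: \<sigma>_def)
  qed (auto simp: A \<alpha>\<beta> complex_eq_iff cos_add sin_add cos_diff sin_diff)
qed

text \<open>Turns a cross-multiplied comparison of the cotangents \<open>N / M\<close> and
  \<open>C / S\<close> into one of cosines, the form that \<open>arccos\<close> needs. The
  inequality is squared; the signs of \<open>C\<close> and \<open>N\<close> decide in which
  direction this is legitimate.\<close>

lemma ge_mult_sqrt_sum_squares:
  fixes N M C S :: real
  assumes "C\<^sup>2 + S\<^sup>2 = 1" "S > 0" "M \<ge> 0" "S * N \<ge> C * M"
  shows "N \<ge> C * sqrt (N\<^sup>2 + M\<^sup>2)"
proof -
  have S2: "S\<^sup>2 = 1 - C\<^sup>2" using assms by simp
  show ?thesis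
  proof (cases "C \<ge> 0")
    case True
    then have "0 \<le> C * M" using assms by simp
    then have "N \<ge> 0" using assms by (metis dual_order.trans zero_le_mult_iff not_less)
    have "(C * M)\<^sup>2 \<le> (S * N)\<^sup>2" using \<open>0 \<le> C * M\<close> assms by (intro power_mono) auto
    then have "C\<^sup>2 * (N\<^sup>2 + M\<^sup>2) \<le> N\<^sup>2"
      by (simp add: power_mult_distrib S2 algebra_simps)
    then have "sqrt (C\<^sup>2 * (N\<^sup>2 + M\<^sup>2)) \<le> N" using \<open>N \<ge> 0\<close> by (rule real_le_lsqrt[rotated])
    then show ?thesis using True by (simp add: real_sqrt_mult)
  next
    case False
    show ?thesis
    proof (cases "N \<ge> 0")
      case True
      then show ?thesis using False
        by (meson dual_order.trans linear mult_nonpos_nonneg real_sqrt_ge_zero sum_power2_ge_zero)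
    next
      case N: False
      have "(S * (- N))\<^sup>2 \<le> ((- C) * M)\<^sup>2" using N assms by (intro power_mono) (auto simp: mult_le_0_iff)
      then have "N\<^sup>2 \<le> C\<^sup>2 * (N\<^sup>2 + M\<^sup>2)"
        by (simp add: power_mult_distrib S2 algebra_simps)
      then have "sqrt (N\<^sup>2) \<le> sqrt (C\<^sup>2 * (N\<^sup>2 + M\<^sup>2))" by (rule real_sqrt_le_mono)
      then show ?thesis using False N by (simp add: real_sqrt_mult)
    qed
  qed
qed

text \<open>Multiplied by \<open>\<bar>d\<bar> / l\<close>, this is the cotangent bound at the real
  point \<open>x\<close>. Tangency is what makes the quadratic in \<open>x\<close> have a double
  root on either side of the line through \<open>a\<close> and \<open>b\<close>.\<close>

lemma dot_ge_cross:
  fixes c k s x :: real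
  assumes "c > 0" "s \<ge> 0" "s\<^sup>2 = c\<^sup>2 - k\<^sup>2" "k\<^sup>2 \<le> 1"
  shows "(c + s) * (x\<^sup>2 - 1 + 2 * c * (c - x * k)) \<ge> (c * (c + s) - 1) * (2 * \<bar>c - x * k\<bar>)"
proof (cases "x * k \<le> c")
  case True
  have "(c + s) * ((c + s) * (x\<^sup>2 - 1 + 2 * c * (c - x * k)) - (c * (c + s) - 1) * (2 * (c - x * k)))
      = ((c + s) * x - k)\<^sup>2"
    using assms(3) by algebra
  then have "(c + s) * (x\<^sup>2 - 1 + 2 * c * (c - x * k)) - (c * (c + s) - 1) * (2 * (c - x * k)) \<ge> 0"
    using assms by (metis add_pos_nonneg zero_le_mult_iff zero_le_power2 not_less)
  then show ?thesis using True by simp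
next
  case False
  \<comment> \<open>Here \<open>x * k > c > 0\<close>. A nonzero \<open>k\<close> gives
    \<open>s < c\<close>, so the second touching point \<open>k / (c - s)\<close> exists and the
    factor \<open>c - s\<close> can be cancelled.\<close>
  then have "k \<noteq> 0" using assms by auto
  then have "s\<^sup>2 < c\<^sup>2" using assms by simp
  then have cs: "c - s > 0" using assms by (simp add: power2_less_imp_less)
  define m where "m = x * k - c"
  have m: "m > 0" using False by (simp add: m_def)
  define N where "N = x\<^sup>2 - 1 - 2 * c * m"
  have "(c - s) * ((c - s) * N - (1 - c * (c - s)) * (2 * m)) = ((c - s) * x - k)\<^sup>2"
    unfolding N_def m_def using assms(3) by algebra
  then have 1: "(c - s) * N - (1 - c * (c - s)) * (2 * m) \<ge> 0"
    using cs by (metis zero_le_mult_iff zero_le_power2 not_less)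
  \<comment> \<open>The surplus \<open>4 * c * m * (1 - k\<^sup>2)\<close> is nonnegative, so the
    bound from the second touching point implies the required one.\<close>
  have "(c - s) * ((c + s) * N - (c * (c + s) - 1) * (2 * m))
      = (c + s) * ((c - s) * N - (1 - c * (c - s)) * (2 * m)) + 4 * c * m * (1 - k\<^sup>2)"
    using assms(3) by algebra
  also have "\<dots> \<ge> 0"
    using 1 assms m by (intro add_nonneg_nonneg mult_nonneg_nonneg) auto
  finally have "(c + s) * N - (c * (c + s) - 1) * (2 * m) \<ge> 0"
    using cs by (metis zero_le_mult_iff not_less)
  moreover have "N = x\<^sup>2 - 1 + 2 * c * (c - x * k)" "\<bar>c - x * k\<bar> = m"
    using m by (simp_all add: N_def m_def algebra_simps)
  ultimately show ?thesis by simp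
qed

text \<open>For distinct points, every real point sees them under an angle of at most
  \<open>arccos C\<close>, and the touching point attains it. The supremum is thus a maximum, with
  sine \<open>S\<close>.\<close>

lemma sin_visual_angle_upper_half_plane:
  fixes c d k l :: real
  assumes pos: "c > 0" "l > 0" and cd: "c\<^sup>2 + d\<^sup>2 = 1" and kl: "k\<^sup>2 + l\<^sup>2 = 1" and kc: "k\<^sup>2 < c\<^sup>2"
    and a: "a = Complex (k * c - l * d) (l * c + k * d)"
    and b: "b = Complex (k * c + l * d) (l * c - k * d)"
  shows "sin (visual_angle_metric upper_half_plane a b) = \<bar>d\<bar> / l * (c + sqrt (c\<^sup>2 - k\<^sup>2))"
proof (cases "d = 0")
  case True
  have im: "Im a > 0" using pos a True by simp
  have "euclidean_angle a z b = 0" if "z \<in> \<real>" for z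
  proof -
    \<comment> \<open>Excludes the default value \<pi> / 2 that division by zero would
      produce.\<close>
    have "a \<noteq> z" using im that by (auto simp: complex_is_Real_iff)
    moreover have "b = a" using True a b by simp
    ultimately show ?thesis
      by (simp add: euclidean_angle_def dot_square_norm power2_eq_square)
  qed
  then have "(\<lambda>z. euclidean_angle a z b) ` \<real> = {0}" by (auto intro: image_eqI[of _ _ 0])
  then show ?thesis
    by (simp add: visual_angle_metric_def frontier_upper_half_plane True)
next
  case False
  define s where "s = sqrt (c\<^sup>2 - k\<^sup>2)"
  have s: "s > 0" "s\<^sup>2 = c\<^sup>2 - k\<^sup>2" using kc by (auto simp: s_def)
  define N where "N x = x\<^sup>2 - 1 + 2 * c * (c - x * k)" for x
  define M where "M x = 2 * \<bar>d\<bar> * \<bar>c - x * k\<bar>" for x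
  \<comment> \<open>Sine and cosine of the angle at the touching point; \<open>S\<close> is positive
    because \<open>d\<close> is nonzero.\<close>
  define S C where "S = \<bar>d\<bar> / l * (c + s)" and "C = (c * (c + s) - 1) / l"
  have "d\<^sup>2 * (c + s)\<^sup>2 + (c * (c + s) - 1)\<^sup>2 = l\<^sup>2"
    using cd kl s(2) by algebra
  then have "((c * (c + s) - 1)\<^sup>2 + d\<^sup>2 * (c + s)\<^sup>2) / l\<^sup>2 = 1"
    using pos by (simp add: add.commute)
  then have CS: "C\<^sup>2 + S\<^sup>2 = 1"
    by (simp add: S_def C_def power_divide power_mult_distrib add_divide_distrib)
  have S: "S > 0" using pos s False by (simp add: S_def)
  have angle: "euclidean_angle a (of_real x) b = arccos (N x / sqrt ((N x)\<^sup>2 + (M x)\<^sup>2))" for x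
  proof -
    have "(a - of_real x) \<bullet> (b - of_real x) = N x"
      unfolding inner_complex_def N_def a b by simp (use cd kl in algebra)
    \<comment> \<open>Lagrange's identity: the squares of dot and cross product add up to the square
      of the product of the lengths.\<close>
    moreover have "cmod (a - of_real x) * cmod (b - of_real x) = sqrt ((N x)\<^sup>2 + (M x)\<^sup>2)"
    proof -
      have "(M x)\<^sup>2 = (2 * d * (c - x * k))\<^sup>2" by (simp add: M_def power_mult_distrib)
      then show ?thesis
        unfolding cmod_def real_sqrt_mult[symmetric] N_def a b
        by simp (use cd kl in algebra)
    qed
    ultimately show ?thesis by (simp add: euclidean_angle_def)
  qed
  have D: "sqrt ((N x)\<^sup>2 + (M x)\<^sup>2) > 0" for x
  proof -
    have "N x \<noteq> 0 \<or> M x \<noteq> 0"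
    proof (rule ccontr)
      assume "\<not> ?thesis"
      then have "x * k = c" "x\<^sup>2 = 1" using False by (auto simp: N_def M_def)
      then have "k\<^sup>2 = c\<^sup>2" by (metis mult_1 power_mult_distrib)
      then show False using kc by simp
    qed
    then show ?thesis by (simp add: sum_power2_gt_zero_iff)
  qed
  have SN: "S * N x \<ge> C * M x" for x
  proof -
    have "k\<^sup>2 \<le> 1" using kl by (metis zero_le_power2 le_add_same_cancel1)
    then have "\<bar>d\<bar> / l * ((c * (c + s) - 1) * (2 * \<bar>c - x * k\<bar>)) \<le> \<bar>d\<bar> / l * ((c + s) * N x)"
      unfolding N_def using pos s by (intro mult_left_mono dot_ge_cross) auto
    then show ?thesis by (simp add: S_def C_def M_def mult_ac)
  qed
  have C1: "\<bar>C\<bar> \<le> 1"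
    using CS by (metis abs_le_square_iff abs_one le_add_same_cancel1 one_power2 zero_le_power2)
  have ratio1: "N x / sqrt ((N x)\<^sup>2 + (M x)\<^sup>2) \<le> 1" for x
    using D[of x] real_le_rsqrt[of "N x" "(N x)\<^sup>2 + (M x)\<^sup>2"] by simp
  have upper: "euclidean_angle a (of_real x) b \<le> arccos C" for x
  proof -
    have "C * sqrt ((N x)\<^sup>2 + (M x)\<^sup>2) \<le> N x"
      using CS S SN by (intro ge_mult_sqrt_sum_squares) (auto simp: M_def)
    then have "C \<le> N x / sqrt ((N x)\<^sup>2 + (M x)\<^sup>2)" using D by (simp add: pos_le_divide_eq)
    then show ?thesis
      unfolding angle using C1 ratio1 by (intro arccos_le_arccos) (simp_all add: abs_le_iff)
  qed
  define x0 where "x0 = k / (c + s)"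
  have x0: "x0 * (c + s) = k" using pos s by (simp add: x0_def)
  have "(c + s) * (c - x0 * k - s) = c\<^sup>2 - s\<^sup>2 - (x0 * (c + s)) * k" by algebra
  also have "\<dots> = 0" unfolding x0 using s(2) by algebra
  finally have "(c + s) * (c - x0 * k - s) = 0" .
  then have x0k: "c - x0 * k = s" using pos s(1) by simp
  \<comment> \<open>At the double root \<open>x0\<close> the cotangent bound \<open>SN\<close>
    becomes an equality.\<close>
  have "(c + s) * (S * N x0) = (c + s) * (C * M x0)"
  proof -
    have "(c + s) * ((c + s) * N x0) = (c + s) * ((c * (c + s) - 1) * (2 * s))"
    proof -
      have "(c + s) * ((c + s) * N x0) = (x0 * (c + s))\<^sup>2 + (c + s)\<^sup>2 * (2 * c * s - 1)"
        unfolding N_def x0k by algebra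
      also have "\<dots> = (c + s) * ((c * (c + s) - 1) * (2 * s))"
        unfolding x0 using s(2) by algebra
      finally show ?thesis .
    qed
    then have "\<bar>d\<bar> / l * ((c + s) * ((c + s) * N x0)) = \<bar>d\<bar> / l * ((c + s) * ((c * (c + s) - 1) * (2 * s)))"
      by simp
    moreover have "M x0 = 2 * \<bar>d\<bar> * s" using s(1) by (simp add: M_def x0k)
    ultimately show ?thesis by (simp add: S_def C_def field_simps)
  qed
  then have eq: "S * N x0 = C * M x0" using pos s(1) by simp
  \<comment> \<open>Equality makes (\<open>N x0\<close>, \<open>M x0\<close>) a multiple of the unit
    vector (\<open>C\<close>, \<open>S\<close>), so normalising its first entry gives
    \<open>C\<close>.\<close>
  have "S\<^sup>2 * ((N x0)\<^sup>2 + (M x0)\<^sup>2) = (M x0)\<^sup>2" using eq CS by algebra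
  then have "sqrt (S\<^sup>2 * ((N x0)\<^sup>2 + (M x0)\<^sup>2)) = M x0" by (simp add: M_def)
  then have "S * sqrt ((N x0)\<^sup>2 + (M x0)\<^sup>2) = M x0" using S by (simp add: real_sqrt_mult)
  then have "S * N x0 = S * (C * sqrt ((N x0)\<^sup>2 + (M x0)\<^sup>2))" using eq by simp
  then have "N x0 = C * sqrt ((N x0)\<^sup>2 + (M x0)\<^sup>2)" using S by simp
  then have "N x0 / sqrt ((N x0)\<^sup>2 + (M x0)\<^sup>2) = C"
    using D[of x0] by (metis nonzero_mult_div_cancel_right less_irrefl)
  then have attained: "euclidean_angle a (of_real x0) b = arccos C" by (simp add: angle)
  have "visual_angle_metric upper_half_plane a b = arccos C"
    unfolding visual_angle_metric_def frontier_upper_half_plane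
  proof (rule cSup_eq_maximum)
    show "arccos C \<in> (\<lambda>z. euclidean_angle a z b) ` \<real>"
      using attained by (intro image_eqI[of _ _ "of_real x0"]) auto
    show "y \<le> arccos C" if "y \<in> (\<lambda>z. euclidean_angle a z b) ` \<real>" for y
      using that upper by (auto elim!: Reals_cases)
  qed
  moreover have "sin (arccos C) = S"
  proof -
    have "sin (arccos C) = sqrt (1 - C\<^sup>2)" using C1 by (intro sin_arccos) (auto simp: abs_le_iff)
    also have "1 - C\<^sup>2 = S\<^sup>2" using CS by simp
    finally show ?thesis using S by simp
  qed
  ultimately show ?thesis by (simp add: S_def s_def)
qed

theorem theorem1p1:
  fixes a b u :: complex and t T :: real
  assumes "a \<in> sphere 0 1 \<inter> upper_half_plane"
    and "b \<in> sphere 0 1 \<inter> upper_half_plane"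
    and "u = (1 + a * b) / (a + b)"
    and "t = cmod (a - b) / cmod (a - cnj b)"
    and "T = (1 + sqrt (1 - (cmod u)\<^sup>2)) * t * sqrt (1 - t\<^sup>2) / sqrt (1 - (cmod u)\<^sup>2 * t\<^sup>2)"
  shows "t = cmod (a - b) / cmod (a * b - 1)
    \<and> sin (visual_angle_metric upper_half_plane a b) = T
    \<and> T = cmod (a - b) / cmod (a * b - 1) * (1 / 2 * cmod (a + b) + sqrt (Im a * Im b))"
proof -
  have ab: "cmod a = 1" "Im a > 0" "cmod b = 1" "Im b > 0"
    using assms(1,2) by (auto simp: upper_half_plane_def)
  obtain c d k l where pos: "c > 0" "l > 0" and cd: "c\<^sup>2 + d\<^sup>2 = 1" and kl: "k\<^sup>2 + l\<^sup>2 = 1"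
    and a: "a = Complex (k * c - l * d) (l * c + k * d)"
    and b: "b = Complex (k * c + l * d) (l * c - k * d)"
    using unit_upper_pair_decomposition[OF ab] by metis
  define s where "s = sqrt (c\<^sup>2 - k\<^sup>2)"
  have im: "Im a * Im b = c\<^sup>2 - k\<^sup>2" unfolding a b by simp (use cd kl in algebra)
  then have kc: "k\<^sup>2 < c\<^sup>2" using ab by (metis diff_gt_0_iff_gt mult_pos_pos)
  have s: "s > 0" "s\<^sup>2 = c\<^sup>2 - k\<^sup>2" using kc by (auto simp: s_def)
  \<comment> \<open>In terms of \<open>m\<close> and \<open>n\<close>,
    \<open>a - b = 2 \<i> d m\<close> and \<open>a - cnj b = 2 \<i> l n\<close>.\<close>
  have diff: "cmod (a - b) = 2 * \<bar>d\<bar>"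
  proof -
    have "cmod (a - b) = sqrt ((2 * d)\<^sup>2)"
      unfolding cmod_def a b by (rule arg_cong[where f = sqrt]) (simp, use kl in algebra)
    then show ?thesis by (simp only: real_sqrt_abs abs_mult abs_numeral)
  qed
  have diff_cnj: "cmod (a - cnj b) = 2 * l"
  proof -
    have "cmod (a - cnj b) = \<bar>2 * l\<bar>"
      unfolding cmod_def real_sqrt_abs[symmetric] a b by (rule arg_cong[where f = sqrt]) (simp, use cd in algebra)
    then show ?thesis using pos by simp
  qed
  \<comment> \<open>Since \<open>n \<cdot> cnj n = 1\<close>, the product is \<open>m\<close>
    squared; as \<open>m \<cdot> cnj m = 1\<close>, it follows that
    \<open>a b - 1 = 2 \<i> l m\<close> and \<open>1 + a b = 2 k m\<close>.\<close>
  have prod: "a * b = Complex k l * Complex k l"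
    unfolding a b by (simp add: complex_eq_iff, intro conjI) (use cd in algebra)+
  have prod_diff: "cmod (a * b - 1) = 2 * l"
  proof -
    have "cmod (a * b - 1) = \<bar>2 * l\<bar>"
      unfolding cmod_def real_sqrt_abs[symmetric] prod by (rule arg_cong[where f = sqrt]) (simp, use kl in algebra)
    then show ?thesis using pos by simp
  qed
  have m1: "cmod (Complex k l) = 1" by (simp add: cmod_def kl)
  have add: "a + b = of_real (2 * c) * Complex k l"
    unfolding a b by (simp add: complex_eq_iff)
  have sum: "cmod (a + b) = 2 * c" using pos by (simp only: add norm_mult m1) simp
  have "1 + a * b = of_real (2 * k) * Complex k l"
    unfolding prod by (simp add: complex_eq_iff) (use kl in algebra)
  then have u: "(cmod u)\<^sup>2 = k\<^sup>2 / c\<^sup>2"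
    by (simp only: assms(3) add norm_divide norm_mult m1) (simp add: power_divide)
  have t: "t = \<bar>d\<bar> / l" by (simp add: assms(4) diff diff_cnj)
  \<comment> \<open>All three radicands in \<open>T\<close> are squares of positive multiples of
    \<open>s\<close>; the \<open>s\<close> in the denominator cancels against that of
    \<open>sqrt (1 - t\<^sup>2)\<close>.\<close>
  have "1 - (cmod u)\<^sup>2 = (s / c)\<^sup>2" using pos s(2) by (simp add: u field_simps)
  then have su: "sqrt (1 - (cmod u)\<^sup>2) = s / c" using pos s(1) by simp
  have dl: "l\<^sup>2 - d\<^sup>2 = s\<^sup>2" using cd kl s(2) by algebra
  have "1 - t\<^sup>2 = (s / l)\<^sup>2" using pos by (simp add: t dl[symmetric] power_divide diff_divide_distrib)
  then have st: "sqrt (1 - t\<^sup>2) = s / l" using pos s(1) by simp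
  have cl: "c\<^sup>2 * l\<^sup>2 - k\<^sup>2 * d\<^sup>2 = s\<^sup>2" using cd kl s(2) by algebra
  have "1 - (cmod u)\<^sup>2 * t\<^sup>2 = (s / (c * l))\<^sup>2"
    using pos by (simp add: u t cl[symmetric] power_divide power_mult_distrib diff_divide_distrib)
  then have sut: "sqrt (1 - (cmod u)\<^sup>2 * t\<^sup>2) = s / (c * l)" using pos s(1) by simp
  have T: "T = \<bar>d\<bar> / l * (c + s)"
    unfolding assms(5) su st sut using pos s(1) by (simp add: t field_simps)
  show ?thesis
  proof (intro conjI)
    show "t = cmod (a - b) / cmod (a * b - 1)" by (simp add: assms(4) diff_cnj prod_diff)
    show "sin (visual_angle_metric upper_half_plane a b) = T"
      using sin_visual_angle_upper_half_plane[OF pos cd kl kc a b] by (simp add: T s_def)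
    show "T = cmod (a - b) / cmod (a * b - 1) * (1 / 2 * cmod (a + b) + sqrt (Im a * Im b))"
      by (simp add: T diff prod_diff sum im s_def)
  qed
qed

end
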